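(* Let $v_1\in\mathbb{R}$ be the stationary velocity of the first car, and let $M^{juw}$, $c^{juw}$ be the matrices and vectors of the multi-anticipative open-road model with $\nu$ cars and $m$ leaders described in the context. For all $y\in\mathbb{R}$ satisfying $$\min_{u\in U}\max_{w\in W}(\alpha_{1uw}y+\beta_{1uw})=v_1,$$ the couple $(\bar v,x)$ is a solution of the system $$\bar v+x_n=\min_{1\le j\le m}\ \min_{u\in U}\ \max_{w\in W}\ \left\{[M^{juw}x]_n+c_n^{juw}\right\},\qquad 1\le n\le\nu,$$ where $\bar v=v_1$ and $x$ is given, up to an additive constant (i.e. up to adding the same real number to all components), by $$x={}^t\big((\nu-1)y,(\nu-2)y,\ldots,y,0\big).$$
   Context: $U$ and $W$ are finite nonempty index sets and $m\ge 1$ is the number of leaders (cars ahead) taken into account. For every $(u,w)\in U\times W$, $(\alpha_{juw})_{1\le j\le m}$ is a non-decreasing (in $j$) sequence of non-negative reals and $(\beta_{juw})_{1\le j\le m}$ is a non-decreasing (in $j$) sequence of reals. The $\nu$ cars $1,\ldots,\nu$ (car $1$ is the leader, car $n-1$ is directly ahead of car $n$) move on an open one-lane road without passing; $x_n(t)$ is the position of car $n$ at time $t$. The first car has a given velocity $v_1(t)$ which tends to the constant $v_1$ as $t\to+\infty$, and $x_1(t+1)=x_1(t)+v_1(t)$; each car $n\ge2$ anticipates with respect to its $j$-th leader for $1\le j\le\min(n-1,m)$, moving by $$x_n(t+1)=x_n(t)+\min_{1\le j\le \min(n-1,m)}\min_{u\in U}\max_{w\in W}\left\{\alpha_{juw}\frac{x_{n-j}(t)-x_n(t)}{j}+\beta_{juw}\right\}.$$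 The matrices $M^{juw}$ and vectors $c^{juw}$ (at the stationary regime, where the velocity of the first car equals $v_1$) are defined by $$[M^{juw}x]_n=\begin{cases}x_n, & 1\le n\le j,\\ \Big(1-\dfrac{\alpha_{juw}}{j}\Big)x_n+\dfrac{\alpha_{juw}}{j}x_{n-j}, & j<n\le\nu,\end{cases}$$ $$c^{juw}_1=v_1,\qquad c^{juw}_n=+\infty\ \ (2\le n\le j),\qquad c^{juw}_n=\beta_{juw}\ \ (j<n\le\nu),$$ with the usual convention $a+(+\infty)=+\infty$ for real $a$, so that entries equal to $+\infty$ play no role in the minimum over $j$. In the system of the claim, $\bar v$ is the asymptotic velocity, common to all cars, and $x$ is the vector of asymptotic car positions.
   Formalization: The claim is proved for positions x respecting the no-passing order (x_n ≤ x_{n-1}), i.e. y ≥ 0 when ν ≥ 2; for negative y it can fail, e.g. m=2, ν=3, α_1=1, α_2=2, β=2, v_1=1, y=-1. *)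

theory Defs
  imports "HOL-Library.Extended_Real"
begin

text \<open>
  Vectors indexed by the cars \<open>1, \<dots>, \<nu>\<close> are functions \<open>nat \<Rightarrow> real\<close>, of which only the values
  on \<open>{1..\<nu>}\<close> matter. The matrix \<open>M\<^sup>j\<^sup>u\<^sup>w\<close> is given by its action on such vectors.
\<close>

definition M_app ::
  "(nat \<Rightarrow> 'u \<Rightarrow> 'w \<Rightarrow> real) \<Rightarrow> nat \<Rightarrow> 'u \<Rightarrow> 'w \<Rightarrow> (nat \<Rightarrow> real) \<Rightarrow> nat \<Rightarrow> real" where
  "M_app \<alpha> j u w x n =
     (if n \<le> j then x n
      else (1 - \<alpha> j u w / real j) * x n + \<alpha> j u w / real j * x (n - j))"

definition c_vec ::
  "real \<Rightarrow> (nat \<Rightarrow> 'u \<Rightarrow> 'w \<Rightarrow> real) \<Rightarrow> nat \<Rightarrow> 'u \<Rightarrow> 'w \<Rightarrow> nat \<Rightarrow> ereal" where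
  "c_vec v1 \<beta> j u w n =
     (if n = 1 then ereal v1 else if n \<le> j then \<infinity> else ereal (\<beta> j u w))"

definition stationary_solution ::
  "nat \<Rightarrow> nat \<Rightarrow> 'u set \<Rightarrow> 'w set \<Rightarrow> (nat \<Rightarrow> 'u \<Rightarrow> 'w \<Rightarrow> real) \<Rightarrow> (nat \<Rightarrow> 'u \<Rightarrow> 'w \<Rightarrow> real)
    \<Rightarrow> real \<Rightarrow> real \<Rightarrow> (nat \<Rightarrow> real) \<Rightarrow> bool" where
  "stationary_solution \<nu> m U W \<alpha> \<beta> v1 v x \<longleftrightarrow>
     (\<forall>n\<in>{1..\<nu>}. ereal v + ereal (x n) =
        (MIN j\<in>{1..m}. MIN u\<in>U. MAX w\<in>W. ereal (M_app \<alpha> j u w x n) + c_vec v1 \<beta> j u w n))"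

text \<open>
  Car \<open>n - 1\<close> is directly ahead of car \<open>n\<close>, and positions increase in the driving direction.
  For at least two cars and equally spaced positions this says that the spacing is nonnegative.
  Monotonicity of \<open>\<alpha>\<close> and \<open>\<beta>\<close> in \<open>j\<close> makes the leaders \<open>j \<ge> 2\<close> irrelevant to the minimum only
  in this case: with singletons \<open>U\<close>, \<open>W\<close>, \<open>m = 2\<close>, \<open>\<nu> = 3\<close>, \<open>\<alpha>\<^sub>1 = 1\<close>, \<open>\<alpha>\<^sub>2 = 2\<close>, \<open>\<beta> = 2\<close>, \<open>v1 = 1\<close>
  and spacing \<open>-1\<close>, the equation for \<open>n = 3\<close> fails.
\<close>

definition no_passing :: "nat \<Rightarrow> (nat \<Rightarrow> real) \<Rightarrow> bool" where
  "no_passing \<nu> x \<longleftrightarrow> (\<forall>n\<in>{2..\<nu>}. x n \<le> x (n - 1))"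

end

theory Submission
  imports Defs
begin

text \<open>
  With equal spacing \<open>y\<close> the \<open>j\<close>-th leader of a car is at distance \<open>j y\<close>, so the factor \<open>1/j\<close> in
  the model cancels and anticipation with respect to leader \<open>j\<close> proposes the velocity
  \<open>\<alpha>\<^sub>j\<^sub>u\<^sub>w y + \<beta>\<^sub>j\<^sub>u\<^sub>w\<close>. The absence of passing forces \<open>y \<ge> 0\<close> as soon as there are two cars; since
  \<open>\<alpha>\<close> and \<open>\<beta>\<close> are non-decreasing in \<open>j\<close>, the proposed velocity is then smallest for the nearest
  leader, for every single choice of \<open>(u, w)\<close> (lemma \<open>nearest_leader_least\<close>). This survives the
  operations \<open>min\<close> over \<open>u\<close> and \<open>max\<close> over \<open>w\<close>, both being monotone, so the minimum over \<open>j\<close> is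
  attained at \<open>j = 1\<close>, where the equation for \<open>y\<close> gives exactly \<open>v1\<close>
  (lemma \<open>nearest_leader_value\<close>). The first car has no leader: there all entries are equal and the
  velocity \<open>v1\<close> is prescribed by \<open>c\<close>.
\<close>

lemma Min_Max_mono:
  fixes f g :: "'u \<Rightarrow> 'w \<Rightarrow> 'c::linorder"
  assumes "finite U" "U \<noteq> {}" "finite W" "W \<noteq> {}"
    and le: "\<And>u w. u \<in> U \<Longrightarrow> w \<in> W \<Longrightarrow> f u w \<le> g u w"
  shows "(MIN u\<in>U. MAX w\<in>W. f u w) \<le> (MIN u\<in>U. MAX w\<in>W. g u w)"
proof -
  have row: "(MAX w\<in>W. f u w) \<le> (MAX w\<in>W. g u w)" if "u \<in> U" for u
  proof (rule Max.boundedI)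
    fix r assume "r \<in> (\<lambda>w. f u w) ` W"
    then show "r \<le> (MAX w\<in>W. g u w)"
      using assms(3,4) le[OF that] by (auto simp: Max_ge_iff)
  qed (use assms(3,4) in auto)
  show ?thesis
    using assms(1,2) row by (auto simp: Min_le_iff)
qed

lemma Min_Max_mono_commute:
  fixes f :: "'u \<Rightarrow> 'w \<Rightarrow> 'c::linorder" and h :: "'c \<Rightarrow> 'd::linorder"
  assumes "mono h" "finite U" "U \<noteq> {}" "finite W" "W \<noteq> {}"
  shows "(MIN u\<in>U. MAX w\<in>W. h (f u w)) = h (MIN u\<in>U. MAX w\<in>W. f u w)"
  using assms by (simp add: mono_Min_commute mono_Max_commute image_image)

lemma spacing_nonneg:
  assumes "\<forall>n\<in>{1..\<nu>}. x n = (real \<nu> - real n) * y + a"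
    and "no_passing \<nu> x" and "2 \<le> \<nu>"
  shows "0 \<le> y"
proof -
  have "x 2 \<le> x 1"
    using assms(2,3) by (force simp: no_passing_def dest: bspec[where x = 2])
  then show ?thesis
    using assms(1,3) by (simp add: algebra_simps)
qed

lemma M_app_equally_spaced:
  assumes "\<forall>n\<in>{1..\<nu>}. x n = (real \<nu> - real n) * y + a"
    and "1 \<le> j" "j < n" "n \<le> \<nu>"
  shows "M_app \<alpha> j u w x n = x n + \<alpha> j u w * y"
proof -
  have "n \<in> {1..\<nu>}" "n - j \<in> {1..\<nu>}"
    using assms(2-4) by auto
  then have "x (n - j) = x n + real j * y"
    using assms(3) by (simp only: assms(1)[rule_format]) (simp add: of_nat_diff algebra_simps)
  then show ?thesis
    using assms(2,3) by (simp add: M_app_def field_simps)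
qed

text \<open>
  For a car with at least \<open>j\<close> leaders this compares the velocities \<open>\<alpha>\<^sub>1\<^sub>u\<^sub>w y + \<beta>\<^sub>1\<^sub>u\<^sub>w\<close> and
  \<open>\<alpha>\<^sub>j\<^sub>u\<^sub>w y + \<beta>\<^sub>j\<^sub>u\<^sub>w\<close>, which uses \<open>y \<ge> 0\<close>. For a car with fewer leaders the inequality holds
  by the choice of \<open>c\<close>: the right-hand side is \<open>\<infinity>\<close>, or, for the first car, both sides agree.
\<close>

lemma nearest_leader_least:
  assumes pos: "\<forall>n\<in>{1..\<nu>}. x n = (real \<nu> - real n) * y + a"
    and "no_passing \<nu> x"
    and "n \<in> {1..\<nu>}" and j: "1 \<le> j"
    and \<alpha>: "\<alpha> 1 u w \<le> \<alpha> j u w" and \<beta>: "\<beta> 1 u w \<le> \<beta> j u w"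
  shows "ereal (M_app \<alpha> 1 u w x n) + c_vec v1 \<beta> 1 u w n
           \<le> ereal (M_app \<alpha> j u w x n) + c_vec v1 \<beta> j u w n"
proof (cases "n = 1")
  case True
  then show ?thesis using j by (simp add: M_app_def c_vec_def)
next
  case False
  show ?thesis
  proof (cases "n \<le> j")
    case True
    then show ?thesis using \<open>n \<noteq> 1\<close> by (simp add: c_vec_def)
  next
    case False
    have "0 \<le> y"
      using spacing_nonneg[OF pos assms(2)] \<open>n \<in> {1..\<nu>}\<close> \<open>n \<noteq> 1\<close> by simp
    then have "\<alpha> 1 u w * y + \<beta> 1 u w \<le> \<alpha> j u w * y + \<beta> j u w"
      using \<alpha> \<beta> by (intro add_mono mult_right_mono)
    then show ?thesis
      using False \<open>n \<noteq> 1\<close> \<open>n \<in> {1..\<nu>}\<close> j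
      by (simp add: M_app_equally_spaced[where x = x, OF pos] c_vec_def del: One_nat_def)
  qed
qed

lemma nearest_leader_value:
  assumes fin: "finite U" "U \<noteq> {}" "finite W" "W \<noteq> {}"
    and pos: "\<forall>n\<in>{1..\<nu>}. x n = (real \<nu> - real n) * y + a"
    and v1: "(MIN u\<in>U. MAX w\<in>W. \<alpha> 1 u w * y + \<beta> 1 u w) = v1"
    and "n \<in> {1..\<nu>}"
  shows "(MIN u\<in>U. MAX w\<in>W. ereal (M_app \<alpha> 1 u w x n) + c_vec v1 \<beta> 1 u w n)
           = ereal v1 + ereal (x n)"
proof (cases "n = 1")
  case True
  then show ?thesis using fin by (simp add: M_app_def c_vec_def add.commute)
next
  case False
  have "ereal (M_app \<alpha> 1 u w x n) + c_vec v1 \<beta> 1 u w n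
          = ereal (x n + (\<alpha> 1 u w * y + \<beta> 1 u w))" for u w
    using False \<open>n \<in> {1..\<nu>}\<close>
    by (simp add: M_app_equally_spaced[where x = x, OF pos] c_vec_def add.assoc del: One_nat_def)
  moreover have "mono (\<lambda>r. ereal (x n + r))"
    by (simp add: mono_def)
  ultimately show ?thesis
    using fin v1 by (simp add: Min_Max_mono_commute[where h = "\<lambda>r. ereal (x n + r)"] add.commute)
qed

theorem theorem2:
  fixes U :: "'u set" and W :: "'w set"
    and m \<nu> :: nat
    and \<alpha> \<beta> :: "nat \<Rightarrow> 'u \<Rightarrow> 'w \<Rightarrow> real"
    and v1 y a :: real
    and x :: "nat \<Rightarrow> real"
  assumes "finite U" and "U \<noteq> {}" and "finite W" and "W \<noteq> {}"
    and "m \<ge> 1" and "\<nu> \<ge> 1"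
    and "\<And>j u w. j \<in> {1..m} \<Longrightarrow> u \<in> U \<Longrightarrow> w \<in> W \<Longrightarrow> 0 \<le> \<alpha> j u w"
    and "\<And>u w. u \<in> U \<Longrightarrow> w \<in> W \<Longrightarrow> mono_on {1..m} (\<lambda>j. \<alpha> j u w)"
    and "\<And>u w. u \<in> U \<Longrightarrow> w \<in> W \<Longrightarrow> mono_on {1..m} (\<lambda>j. \<beta> j u w)"
    and "(MIN u\<in>U. MAX w\<in>W. \<alpha> 1 u w * y + \<beta> 1 u w) = v1"
    and "\<And>n. n \<in> {1..\<nu>} \<Longrightarrow> x n = (real \<nu> - real n) * y + a"
    and "no_passing \<nu> x"
  shows "stationary_solution \<nu> m U W \<alpha> \<beta> v1 v1 x"
  unfolding stationary_solution_def
proof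
  have pos: "\<forall>n\<in>{1..\<nu>}. x n = (real \<nu> - real n) * y + a"
    using assms(11) by blast
  fix n assume n: "n \<in> {1..\<nu>}"
  define F where "F j = (MIN u\<in>U. MAX w\<in>W. ereal (M_app \<alpha> j u w x n) + c_vec v1 \<beta> j u w n)" for j
  have F1: "F 1 = ereal v1 + ereal (x n)"
    unfolding F_def using assms(1-4) pos assms(10) n by (rule nearest_leader_value)
  have "F 1 \<le> F j" if j: "j \<in> {1..m}" for j
    unfolding F_def
  proof (rule Min_Max_mono[OF assms(1-4)])
    fix u w assume "u \<in> U" "w \<in> W"
    then have "\<alpha> 1 u w \<le> \<alpha> j u w" "\<beta> 1 u w \<le> \<beta> j u w"
      using mono_onD[OF assms(8), of u w 1 j] mono_onD[OF assms(9), of u w 1 j] j by simp_all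
    then show "ereal (M_app \<alpha> 1 u w x n) + c_vec v1 \<beta> 1 u w n
                 \<le> ereal (M_app \<alpha> j u w x n) + c_vec v1 \<beta> j u w n"
      using pos assms(12) n j by (intro nearest_leader_least) auto
  qed
  then have "(MIN j\<in>{1..m}. F j) = F 1"
    using \<open>m \<ge> 1\<close> by (intro Min_eqI) auto
  then show "ereal v1 + ereal (x n) =
      (MIN j\<in>{1..m}. MIN u\<in>U. MAX w\<in>W. ereal (M_app \<alpha> j u w x n) + c_vec v1 \<beta> j u w n)"
    using F1 by (simp add: F_def)
qed

end
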